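(* Let $n\ge 1$, let $u\in C^\infty(\mathbb{R}^n)\cap L^\infty(\mathbb{R}^n)$ and let $m\ge 1$ be an integer. Then $u$ solves $(-\Delta)^m u=u$ in $\mathbb{R}^n$ if and only if $-\Delta u=u$ in $\mathbb{R}^n$.
   Context: Here $(-\Delta)^m$ is the $m$-th iterate of the classical operator $-\Delta$ on $\mathbb{R}^n$. *)

theory Defs
  imports "HOL-Analysis.Analysis" "HOL-Probability.Essential_Supremum"
begin

definition partial :: "'n \<Rightarrow> (real ^ 'n \<Rightarrow> real) \<Rightarrow> real ^ 'n \<Rightarrow> real" where
  "partial i f x = deriv (\<lambda>t. f (x + t *\<^sub>R axis i 1)) 0"

(* deriv is total, so partial i f x is meaningful only where the partial derivative exists;
   the definition of smooth therefore demands existence at every stage explicitly. *)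

definition iter_partial :: "'n list \<Rightarrow> (real ^ 'n \<Rightarrow> real) \<Rightarrow> real ^ 'n \<Rightarrow> real" where
  "iter_partial is f = foldr partial is f"

text \<open>Membership in \<open>C\<^sup>\<infinity>\<close>: the partial derivatives of all orders (a list of coordinate indices
  records the order of differentiation) exist everywhere and are continuous.\<close>

definition smooth :: "(real ^ 'n \<Rightarrow> real) \<Rightarrow> bool" where
  "smooth f \<longleftrightarrow>
     (\<forall>is. continuous_on UNIV (iter_partial is f) \<and>
           (\<forall>i x. (\<lambda>t. iter_partial is f (x + t *\<^sub>R axis i 1)) differentiable (at 0)))"

definition L_infinity :: "(real ^ 'n \<Rightarrow> real) \<Rightarrow> bool" where
  "L_infinity f \<longleftrightarrow> f \<in> borel_measurable lebesgue \<and> esssup lebesgue (\<lambda>x. ereal \<bar>f x\<bar>) < \<infinity>"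

definition laplacian :: "(real ^ 'n \<Rightarrow> real) \<Rightarrow> real ^ 'n \<Rightarrow> real" where
  "laplacian f x = (\<Sum>i\<in>UNIV. partial i (partial i f) x)"

definition neg_laplacian :: "(real ^ 'n \<Rightarrow> real) \<Rightarrow> real ^ 'n \<Rightarrow> real" where
  "neg_laplacian f x = - laplacian f x"

end

theory Submission
  imports Defs "HOL-Probability.Sinc_Integral"
begin

text \<open>
Write \<open>L\<close> for \<open>-\<Delta>\<close> and \<open>w = L u - u\<close>. If \<open>L\<^sup>m u = u\<close>, then \<open>L\<^sup>m w = w\<close> and
  \<open>w + L w + \<dots> + L\<^sup>m\<^sup>-\<^sup>1 w = 0\<close>. For a symmetric nonnegative operator on a Hilbert space this would
  give \<open>w = 0\<close> at once: in the inner product of the sum with \<open>w\<close> the term \<open>\<langle>L\<^sup>2\<^sup>k w, w\<rangle>\<close> equals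
  \<open>\<parallel>L\<^sup>k w\<parallel>\<^sup>2\<close> and \<open>\<langle>L\<^sup>2\<^sup>k\<^sup>+\<^sup>1 w, w\<rangle>\<close> is the Dirichlet energy of \<open>L\<^sup>k w\<close>, so all terms are nonnegative
  and the first one is \<open>\<parallel>w\<parallel>\<^sup>2\<close>.

A bounded \<open>w\<close> need not be square integrable, so Lebesgue measure is replaced by an integrable weight
  depending on \<open>e > 0\<close> whose gradient is at most \<open>e\<close> times the weight, coordinatewise. In the
  weighted inner product \<open>L\<close> is symmetric and nonnegative up to errors of order \<open>e\<close> relative to the
  energies of the functions (\<open>weighted_integration_by_parts\<close>). The sequence \<open>L\<^sup>j w\<close> is periodic in
  \<open>j\<close>, so its energies have a finite sum \<open>T\<close> over a period, and the argument above, applied to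
  every \<open>L\<^sup>j w\<close>, yields \<open>T \<le> C e T\<close> with \<open>C\<close> depending only on \<open>m\<close> and the dimension
  (\<open>almost_symmetric_energy_bound\<close>). A small \<open>e\<close> gives \<open>T = 0\<close> (\<open>periodic_chain_vanishes\<close>).

The energies are finite if \<open>u\<close> has enough bounded derivatives. Only \<open>u\<close> itself is assumed to be
  bounded, but averages of \<open>u\<close> over segments in all coordinate directions have one more order of
  bounded derivatives, satisfy the same equation, and converge to \<open>u\<close> as the segments shrink. This
  reduces the general case to the one with many bounded derivatives (\<open>polyharmonic_eigenfunction\<close>).
\<close>

section \<open>Calculus of smooth functions\<close>

abbreviation ax :: "'n::finite \<Rightarrow> real ^ 'n" where
  "ax i \<equiv> axis i 1"

lemma partial_eqI:
  "((\<lambda>t. f (x + t *\<^sub>R ax i)) has_field_derivative D) (at 0) \<Longrightarrow> partial i f x = D"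
  unfolding partial_def by (rule DERIV_imp_deriv)

lemma smooth_imp_continuous: "smooth f \<Longrightarrow> continuous_on UNIV f"
  unfolding smooth_def by (metis foldr.simps(1) id_apply iter_partial_def)

lemma smooth_partial: "smooth f \<Longrightarrow> smooth (partial i f)"
proof -
  assume "smooth f"
  moreover have "iter_partial is (partial i f) = iter_partial (is @ [i]) f" for "is"
    by (simp add: iter_partial_def)
  ultimately show ?thesis
    unfolding smooth_def by metis
qed

lemma smooth_has_partial_derivative:
  assumes "smooth f"
  shows "((\<lambda>t. f (x + t *\<^sub>R ax i)) has_field_derivative partial i f (x + s *\<^sub>R ax i)) (at s)"
proof -
  let ?y = "x + s *\<^sub>R ax i"
  have "(\<lambda>t. iter_partial [] f (?y + t *\<^sub>R ax i)) differentiable (at 0)"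
    using assms unfolding smooth_def by blast
  then have "(\<lambda>t. f (?y + t *\<^sub>R ax i)) differentiable (at 0)"
    by (simp add: iter_partial_def)
  then obtain D where D: "((\<lambda>t. f (?y + t *\<^sub>R ax i)) has_field_derivative D) (at 0)"
    using real_differentiable_def by blast
  then have "partial i f ?y = D"
    by (rule partial_eqI)
  moreover have "(\<lambda>t. f (?y + t *\<^sub>R ax i)) = (\<lambda>t. f (x + (t + s) *\<^sub>R ax i))"
    by (simp add: algebra_simps)
  ultimately have "((\<lambda>t. f (x + (t + s) *\<^sub>R ax i)) has_field_derivative partial i f ?y) (at 0)"
    using D by simp
  then show ?thesis
    using DERIV_shift[of "\<lambda>t. f (x + t *\<^sub>R ax i)" "partial i f ?y" 0 s] by simp
qed

lemma smooth_has_partial_derivative_0: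
  "smooth f \<Longrightarrow> ((\<lambda>t. f (x + t *\<^sub>R ax i)) has_field_derivative partial i f x) (at 0)"
  using smooth_has_partial_derivative[of f x i 0] by simp

text \<open>Smoothness is the greatest property of functions that implies continuity and existence of
  the partial derivatives and is inherited by the partial derivatives. To show that an operation
  preserves smoothness, it is enough to take for \<open>S\<close> its range on smooth functions and to commute it
  with one partial derivative.\<close>

lemma smooth_coinduct:
  assumes "S f"
    and "\<And>g. S g \<Longrightarrow> continuous_on UNIV g"
    and "\<And>g i x. S g \<Longrightarrow> \<exists>D. ((\<lambda>t. g (x + t *\<^sub>R ax i)) has_field_derivative D) (at 0)"
    and "\<And>g i. S g \<Longrightarrow> S (partial i g)"
  shows "smooth f"
proof -
  have "S (iter_partial is f)" for "is"
    by (induction "is") (use assms in \<open>auto simp: iter_partial_def\<close>)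
  then show ?thesis
    unfolding smooth_def using assms(2,3) real_differentiable_def by blast
qed

lemma partial_linear_combination:
  assumes "smooth f" "smooth g"
  shows "partial i (\<lambda>x. a * f x + b * g x) = (\<lambda>x. a * partial i f x + b * partial i g x)"
proof
  fix x
  show "partial i (\<lambda>x. a * f x + b * g x) x = a * partial i f x + b * partial i g x"
    by (intro partial_eqI derivative_intros DERIV_cmult smooth_has_partial_derivative_0 assms)
qed

lemma smooth_linear_combination:
  assumes "smooth f" "smooth g"
  shows "smooth (\<lambda>x. a * f x + b * g x)"
proof (rule smooth_coinduct
    [where S = "\<lambda>w. \<exists>f g. smooth f \<and> smooth g \<and> w = (\<lambda>x. a * f x + b * g x)"], goal_cases)
  case 1
  then show ?case using assms by blast
next
  case (2 w)
  then obtain f g where fg: "smooth f" "smooth g" "w = (\<lambda>x. a * f x + b * g x)" by blast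
  show ?case
    unfolding fg(3) by (intro continuous_intros smooth_imp_continuous fg)
next
  case (3 w i x)
  then obtain f g where fg: "smooth f" "smooth g" "w = (\<lambda>x. a * f x + b * g x)" by blast
  have "((\<lambda>t. w (x + t *\<^sub>R ax i)) has_field_derivative a * partial i f x + b * partial i g x) (at 0)"
    unfolding fg(3) 
    by (intro derivative_intros DERIV_cmult smooth_has_partial_derivative_0 fg)
  then show ?case by blast
next
  case (4 w i)
  then show ?case using partial_linear_combination smooth_partial by metis
qed

lemma partial_diff:
  "smooth f \<Longrightarrow> smooth g \<Longrightarrow> partial i (\<lambda>x. f x - g x) = (\<lambda>x. partial i f x - partial i g x)"
  using partial_linear_combination[of f g i 1 "-1"] by simp

lemma partial_translate: "partial i (\<lambda>x. f (x + v)) = (\<lambda>x. partial i f (x + v))"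
  by (simp add: partial_def fun_eq_iff algebra_simps)

lemma smooth_translate:
  assumes "smooth f"
  shows "smooth (\<lambda>x. f (x + v))"
proof (rule smooth_coinduct[where S = "\<lambda>w. \<exists>f. smooth f \<and> w = (\<lambda>x. f (x + v))"], goal_cases)
  case 1
  then show ?case using assms by blast
next
  case (2 w)
  then show ?case
    by (auto intro!: continuous_on_compose2[OF smooth_imp_continuous] continuous_intros)
next
  case (3 w i x)
  then obtain f where f: "smooth f" "w = (\<lambda>x. f (x + v))" by blast
  show ?case
    using smooth_has_partial_derivative_0[OF f(1), of "x + v" i] unfolding f(2)
    by (auto simp: algebra_simps)
next
  case (4 w i)
  then show ?case using partial_translate smooth_partial by metis
qed

lemma smooth_sum:
  assumes "\<And>i. i \<in> I \<Longrightarrow> smooth (f i)"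
  shows "smooth (\<lambda>x. \<Sum>i\<in>I. f i x)"
proof -
  have z: "smooth (\<lambda>x::real^'n. 0)"
    by (rule smooth_coinduct[where S = "\<lambda>w. w = (\<lambda>x. 0)"])
      (auto simp: partial_def fun_eq_iff intro: derivative_intros)
  show ?thesis
    using assms
  proof (induction I rule: infinite_finite_induct)
    case (insert i I)
    then show ?case
      using smooth_linear_combination[of "f i" "\<lambda>x. \<Sum>i\<in>I. f i x" 1 1] by simp
  qed (use z in simp_all)
qed

lemma neg_laplacian_eq: "neg_laplacian f = (\<lambda>x. - (\<Sum>i\<in>UNIV. partial i (partial i f) x))"
  by (simp add: fun_eq_iff neg_laplacian_def laplacian_def)

lemma smooth_neg_laplacian: "smooth f \<Longrightarrow> smooth (neg_laplacian f)"
  unfolding neg_laplacian_eq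
  using smooth_linear_combination[of "\<lambda>x. \<Sum>i\<in>UNIV. partial i (partial i f) x"
      "\<lambda>x. \<Sum>i\<in>UNIV. partial i (partial i f) x" "-1" 0]
  by (simp add: smooth_sum smooth_partial)

lemma smooth_neg_laplacian_funpow: "smooth f \<Longrightarrow> smooth ((neg_laplacian ^^ j) f)"
  by (induction j) (auto intro: smooth_neg_laplacian)

lemma neg_laplacian_diff:
  assumes "smooth f" "smooth g"
  shows "neg_laplacian (\<lambda>x. f x - g x) = (\<lambda>x. neg_laplacian f x - neg_laplacian g x)"
  by (simp add: fun_eq_iff neg_laplacian_eq partial_diff assms smooth_partial sum_subtractf)

section \<open>Functions with finitely many bounded derivatives\<close>

text \<open>The recursion peels off the innermost
  derivative, so that an operation commuting with \<open>partial\<close> is handled by one induction on \<open>k\<close>.\<close>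

primrec bounded_partials :: "nat \<Rightarrow> (real ^ 'n::finite \<Rightarrow> real) \<Rightarrow> bool" where
  "bounded_partials 0 f \<longleftrightarrow> smooth f \<and> bounded (range f)"
| "bounded_partials (Suc k) f \<longleftrightarrow>
     smooth f \<and> bounded (range f) \<and> (\<forall>i. bounded_partials k (partial i f))"

lemma bounded_partials_smooth: "bounded_partials k f \<Longrightarrow> smooth f"
  by (cases k) auto

lemma bounded_partials_bounded: "bounded_partials k f \<Longrightarrow> bounded (range f)"
  by (cases k) auto

lemma bounded_partials_Suc_D: "bounded_partials (Suc k) f \<Longrightarrow> bounded_partials k f"
proof (induction k arbitrary: f)
  case (Suc k)
  then show ?case
    by (metis bounded_partials.simps(2))
qed auto

lemma bounded_partials_mono: "bounded_partials k f \<Longrightarrow> j \<le> k \<Longrightarrow> bounded_partials j f"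
  by (induction k) (metis bounded_partials_Suc_D le_Suc_eq le_zero_eq)+

lemma bounded_linear_combination:
  fixes f g :: "'a \<Rightarrow> real"
  assumes "bounded (range f)" "bounded (range g)"
  shows "bounded (range (\<lambda>x. a * f x + b * g x))"
proof -
  have "bounded (range (\<lambda>x. a * f x))" "bounded (range (\<lambda>x. b * g x))"
    using assms[THEN bounded_scaling, of a] assms[THEN bounded_scaling, of b]
    by (simp_all add: image_image)
  then show ?thesis
    by (rule bounded_plus_comp)
qed

lemma bounded_partials_linear_combination:
  "bounded_partials k f \<Longrightarrow> bounded_partials k g \<Longrightarrow>
    bounded_partials k (\<lambda>x. a * f x + b * g x)"
proof (induction k arbitrary: f g)
  case 0
  then have "bounded (range (\<lambda>x. a * f x + b * g x))"
    by (intro bounded_linear_combination) auto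
  with 0 show ?case
    by (simp add: smooth_linear_combination)
next
  case (Suc k)
  then have "bounded (range (\<lambda>x. a * f x + b * g x))"
    by (intro bounded_linear_combination) auto
  with Suc show ?case
    by (simp add: smooth_linear_combination partial_linear_combination)
qed

lemma bounded_partials_diff:
  "bounded_partials k f \<Longrightarrow> bounded_partials k g \<Longrightarrow> bounded_partials k (\<lambda>x. f x - g x)"
  using bounded_partials_linear_combination[of k f g 1 "-1"] by simp

lemma bounded_partials_translate:
  "bounded_partials k f \<Longrightarrow> bounded_partials k (\<lambda>x. f (x + v))"
proof (induction k arbitrary: f)
  case 0
  then show ?case
    by (auto simp: smooth_translate bounded_iff)
next
  case (Suc k)
  then show ?case
    by (auto simp: smooth_translate bounded_iff partial_translate)
qed

lemma bounded_partials_sum: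
  assumes "finite I" "I \<noteq> {}" "\<And>i. i \<in> I \<Longrightarrow> bounded_partials k (f i)"
  shows "bounded_partials k (\<lambda>x. \<Sum>i\<in>I. f i x)"
  using assms
proof (induction I rule: finite_ne_induct)
  case (insert i I)
  then show ?case
    using bounded_partials_linear_combination[of k "f i" "\<lambda>x. \<Sum>i\<in>I. f i x" 1 1] by simp
qed simp

lemma bounded_partials_neg_laplacian:
  assumes "bounded_partials (Suc (Suc k)) f"
  shows "bounded_partials k (neg_laplacian f)"
proof -
  have s: "bounded_partials k (\<lambda>x. \<Sum>i\<in>UNIV. partial i (partial i f) x)"
    using assms by (intro bounded_partials_sum) auto
  show ?thesis
    unfolding neg_laplacian_eq
    using bounded_partials_linear_combination[OF s s, of "-1" 0] by simp
qed

lemma bounded_partials_neg_laplacian_funpow: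
  "bounded_partials (2 * j + k) f \<Longrightarrow> bounded_partials k ((neg_laplacian ^^ j) f)"
proof (induction j arbitrary: k)
  case (Suc j)
  have "bounded_partials (Suc (Suc k)) ((neg_laplacian ^^ j) f)"
    using Suc.prems by (intro Suc.IH) (simp del: bounded_partials.simps)
  then show ?case
    using bounded_partials_neg_laplacian by simp
qed simp

section \<open>Averaging along coordinate directions\<close>

text \<open>The mean value of \<open>f\<close> on the segment from \<open>x\<close> to \<open>x + h e\<^sub>i\<close>. The parametrisation by \<open>{0..1}\<close>
  keeps it meaningful at \<open>h = 0\<close>, where it returns \<open>f x\<close>, and makes it continuous in \<open>h\<close> there.\<close>

definition average :: "'n::finite \<Rightarrow> real \<Rightarrow> (real ^ 'n \<Rightarrow> real) \<Rightarrow> real ^ 'n \<Rightarrow> real" where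
  "average i h f x = integral {0..1} (\<lambda>s. f (x + (h * s) *\<^sub>R ax i))"

lemma average_integrand_integrable:
  fixes f :: "real ^ 'n::finite \<Rightarrow> real"
  assumes "continuous_on UNIV f"
  shows "(\<lambda>s. f (x + (h * s) *\<^sub>R ax i)) integrable_on {0..1}"
  by (rule integrable_continuous_real, rule continuous_on_compose2[OF assms])
    (auto intro!: continuous_intros)

lemma continuous_on_average:
  assumes "continuous_on UNIV f"
  shows "continuous_on UNIV (average i h f)"
proof -
  have "continuous_on (UNIV \<times> cbox 0 1) (\<lambda>(x, s). f (x + (h * s) *\<^sub>R ax i))"
    unfolding case_prod_unfold
    by (intro continuous_on_compose2[OF assms] continuous_intros) auto
  then have "continuous_on UNIV (\<lambda>x. integral (cbox 0 1) (\<lambda>s. f (x + (h * s) *\<^sub>R ax i)))"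
    by (rule integral_continuous_on_param)
  then show ?thesis
    by (simp add: average_def [abs_def])
qed

lemma average_has_partial_derivative:
  assumes "smooth f"
  shows "((\<lambda>t. average i h f (x + t *\<^sub>R ax j)) has_field_derivative
    average i h (partial j f) x) (at 0)"
proof -
  have c: "continuous_on (UNIV \<times> cbox 0 1)
      (\<lambda>(t, s). partial j f (x + (h * s) *\<^sub>R ax i + t *\<^sub>R ax j))"
    unfolding case_prod_unfold
    by (intro continuous_on_compose2[OF smooth_imp_continuous[OF smooth_partial[OF assms]]]
        continuous_intros) auto
  have "((\<lambda>t. integral (cbox 0 1) (\<lambda>s. f (x + (h * s) *\<^sub>R ax i + t *\<^sub>R ax j)))
      has_field_derivative
        integral (cbox 0 1) (\<lambda>s. partial j f (x + (h * s) *\<^sub>R ax i + 0 *\<^sub>R ax j)))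
      (at 0 within UNIV)"
  proof (rule leibniz_rule_field_derivative[OF _ _ c])
    show "(\<lambda>s. f (x + (h * s) *\<^sub>R ax i + t *\<^sub>R ax j)) integrable_on cbox 0 1" for t
      by (intro integrable_continuous continuous_intros
          continuous_on_compose2[OF smooth_imp_continuous[OF assms]]) auto
  qed (auto intro: smooth_has_partial_derivative assms)
  then show ?thesis
    by (simp add: average_def [abs_def] algebra_simps)
qed

lemma partial_average: "smooth f \<Longrightarrow> partial j (average i h f) = average i h (partial j f)"
  by (intro ext partial_eqI average_has_partial_derivative)

text \<open>In the direction of averaging the derivative is a difference quotient of \<open>f\<close> itself, so its
  bounds involve only the bounds of \<open>f\<close>. This gain of one bounded derivative is the purpose of the
  averages.\<close>

lemma partial_average_same:
  assumes "smooth f" "h \<noteq> 0"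
  shows "partial i (average i h f) = (\<lambda>x. (f (x + h *\<^sub>R ax i) - f x) / h)"
proof
  fix x
  have d: "((\<lambda>s. f (x + (h * s) *\<^sub>R ax i) / h) has_field_derivative
      partial i f (x + (h * s) *\<^sub>R ax i)) (at s)" for s
  proof -
    have "((\<lambda>s. f (x + (h * s) *\<^sub>R ax i)) has_field_derivative
        partial i f (x + (h * s) *\<^sub>R ax i) * h) (at s)"
      by (rule DERIV_chain2[where f = "\<lambda>t. f (x + t *\<^sub>R ax i)" and g = "\<lambda>s. h * s"])
        (auto intro!: smooth_has_partial_derivative assms derivative_eq_intros)
    from DERIV_cdivide[OF this, of h] show ?thesis
      using assms(2) by simp
  qed
  have "((\<lambda>s. partial i f (x + (h * s) *\<^sub>R ax i)) has_integral
      f (x + (h * 1) *\<^sub>R ax i) / h - f (x + (h * 0) *\<^sub>R ax i) / h) {0..1}"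
    by (intro fundamental_theorem_of_calculus)
      (auto simp: has_real_derivative_iff_has_vector_derivative[symmetric]
        intro: has_field_derivative_at_within[OF d])
  then show "partial i (average i h f) x = (f (x + h *\<^sub>R ax i) - f x) / h"
    unfolding partial_average[OF assms(1)] average_def
    by (simp add: integral_unique diff_divide_distrib)
qed

lemma smooth_average:
  assumes "smooth f"
  shows "smooth (average i h f)"
proof (rule smooth_coinduct[where S = "\<lambda>w. \<exists>f. smooth f \<and> w = average i h f"], goal_cases)
  case 1
  then show ?case using assms by blast
next
  case (2 w)
  then show ?case using continuous_on_average smooth_imp_continuous by blast
next
  case (3 w j x)
  then show ?case using average_has_partial_derivative by blast
next
  case (4 w j)
  then show ?case using partial_average smooth_partial by metis
qed

lemma bounded_average:
  assumes "continuous_on UNIV f" "bounded (range f)"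
  shows "bounded (range (average i h f))"
proof -
  obtain B where B: "\<And>x. \<bar>f x\<bar> \<le> B"
    using assms(2) by (auto simp: bounded_iff)
  have "norm (average i h f x) \<le> B" for x
  proof -
    have "norm (average i h f x) \<le> integral {0..1} (\<lambda>s::real. B)"
      unfolding average_def using B
      by (intro integral_norm_bound_integral average_integrand_integrable assms) auto
    then show ?thesis by simp
  qed
  then show ?thesis
    by (auto simp: bounded_iff)
qed

lemma bounded_partials_average: "bounded_partials k f \<Longrightarrow> bounded_partials k (average i h f)"
proof (induction k arbitrary: f)
  case 0
  then show ?case by (auto simp: smooth_average bounded_average smooth_imp_continuous)
next
  case (Suc k)
  then show ?case
    by (auto simp: smooth_average bounded_average smooth_imp_continuous partial_average)
qed

lemma neg_laplacian_average:
  assumes "smooth f"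
  shows "neg_laplacian (average i h f) = average i h (neg_laplacian f)"
proof
  fix x
  have "average i h (neg_laplacian f) x =
      - integral {0..1} (\<lambda>s. \<Sum>j\<in>UNIV. partial j (partial j f) (x + (h * s) *\<^sub>R ax i))"
    unfolding average_def neg_laplacian_eq by simp
  also have "\<dots> = - (\<Sum>j\<in>UNIV. average i h (partial j (partial j f)) x)"
    unfolding average_def
    by (subst integral_sum)
      (auto intro!: average_integrand_integrable smooth_imp_continuous smooth_partial assms)
  also have "\<dots> = neg_laplacian (average i h f) x"
    by (simp add: neg_laplacian_eq partial_average assms smooth_partial)
  finally show "neg_laplacian (average i h f) x = average i h (neg_laplacian f) x" ..
qed

text \<open>A continuous function is recovered from its averages by letting the length \<open>h\<close> of the segment
  tend to \<open>0\<close>.\<close>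

lemma average_inject:
  assumes f: "continuous_on UNIV f" and g: "continuous_on UNIV g"
    and eq: "\<And>h. h > 0 \<Longrightarrow> average i h f = average i h g"
  shows "f = g"
proof
  fix x
  have lim: "((\<lambda>h. average i h w x) \<longlongrightarrow> w x) (at_right 0)" if w: "continuous_on UNIV w" for w
  proof -
    have "continuous_on (UNIV \<times> cbox 0 1) (\<lambda>(h, s). w (x + (h * s) *\<^sub>R ax i))"
      unfolding case_prod_unfold
      by (intro continuous_on_compose2[OF w] continuous_intros) auto
    then have "continuous_on UNIV (\<lambda>h. integral (cbox 0 1) (\<lambda>s. w (x + (h * s) *\<^sub>R ax i)))"
      by (rule integral_continuous_on_param)
    then have "isCont (\<lambda>h. average i h w x) 0"
      by (simp add: average_def continuous_on_eq_continuous_at)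
    then have "((\<lambda>h. average i h w x) \<longlongrightarrow> average i 0 w x) (at_right 0)"
      unfolding isCont_def by (rule tendsto_within_subset) auto
    then show ?thesis by (simp add: average_def)
  qed
  have "\<forall>\<^sub>F h in at_right 0. average i h f x = average i h g x"
    using eq by (auto simp: eventually_at_filter)
  then have "((\<lambda>h. average i h g x) \<longlongrightarrow> f x) (at_right 0)"
    using lim[OF f] by (simp add: tendsto_cong)
  then show "f x = g x"
    using lim[OF g] by (intro tendsto_unique[of "at_right (0::real)"]) auto
qed

primrec averages :: "('n::finite \<times> real) list \<Rightarrow> (real ^ 'n \<Rightarrow> real) \<Rightarrow> real ^ 'n \<Rightarrow> real" where
  "averages [] f = f"
| "averages (p # ps) f = average (fst p) (snd p) (averages ps f)"

lemma continuous_on_averages: "continuous_on UNIV f \<Longrightarrow> continuous_on UNIV (averages ps f)"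
  by (induction ps) (auto intro: continuous_on_average)

lemma smooth_averages: "smooth f \<Longrightarrow> smooth (averages ps f)"
  by (induction ps) (auto intro: smooth_average)

lemma bounded_partials_averages: "bounded_partials k f \<Longrightarrow> bounded_partials k (averages ps f)"
  by (induction ps) (auto intro: bounded_partials_average)

lemma neg_laplacian_averages:
  "smooth f \<Longrightarrow> neg_laplacian (averages ps f) = averages ps (neg_laplacian f)"
  by (induction ps) (auto simp: neg_laplacian_average smooth_averages)

lemma neg_laplacian_funpow_averages:
  "smooth f \<Longrightarrow> (neg_laplacian ^^ j) (averages ps f) = averages ps ((neg_laplacian ^^ j) f)"
  by (induction j) (auto simp: neg_laplacian_averages smooth_neg_laplacian_funpow)

text \<open>The partial derivative in direction \<open>j\<close> moves through the outer averages until it meets the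
  first one in direction \<open>j\<close>, where it turns into a difference quotient.\<close>

lemma bounded_partials_partial_averages:
  assumes "bounded_partials k f" "j \<in> fst ` set ps" "\<forall>p\<in>set ps. snd p \<noteq> 0"
  shows "bounded_partials k (partial j (averages ps f))"
  using assms(2,3)
proof (induction ps)
  case (Cons p ps)
  let ?g = "averages ps f"
  have g: "bounded_partials k ?g" "smooth ?g"
    using assms(1) by (auto intro: bounded_partials_averages bounded_partials_smooth)
  show ?case
  proof (cases "fst p = j")
    case True
    have "bounded_partials k (\<lambda>x. 1 / snd p * ?g (x + snd p *\<^sub>R ax j) + (- 1 / snd p) * ?g x)"
      by (intro bounded_partials_linear_combination bounded_partials_translate g)
    then show ?thesis
      using True Cons.prems(2) g by (simp add: partial_average_same diff_divide_distrib)
  next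
    case False
    then show ?thesis
      using Cons g by (auto simp: partial_average intro!: bounded_partials_average)
  qed
qed simp

lemma bounded_partials_Suc_averages:
  assumes "bounded_partials k f" "fst ` set ps = UNIV" "\<forall>p\<in>set ps. snd p \<noteq> 0"
  shows "bounded_partials (Suc k) (averages ps f)"
  using bounded_partials_partial_averages[OF assms(1) _ assms(3)]
    bounded_partials_averages[OF assms(1), of ps] assms(2)
  by (auto intro: bounded_partials_smooth bounded_partials_bounded)

lemma averages_inject:
  assumes "continuous_on UNIV f" "continuous_on UNIV g"
    and "\<And>ps. map fst ps = is \<Longrightarrow> \<forall>p\<in>set ps. snd p > 0 \<Longrightarrow> averages ps f = averages ps g"
  shows "f = g"
  using assms(3)
proof (induction "is")
  case Nil
  then show ?case using Nil[of "[]"] by simp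
next
  case (Cons i "is")
  show ?case
  proof (rule Cons.IH)
    fix ps :: "('a \<times> real) list"
    assume ps: "map fst ps = is" "\<forall>p\<in>set ps. snd p > 0"
    show "averages ps f = averages ps g"
    proof (rule average_inject)
      fix h :: real
      assume "h > 0"
      then show "average i h (averages ps f) = average i h (averages ps g)"
        using Cons.prems[of "(i, h) # ps"] ps by simp
    qed (intro continuous_on_averages assms)+
  qed
qed

section \<open>An integrable weight with small logarithmic gradient\<close>

text \<open>The product form makes integrability a one-dimensional question about \<open>1 / (1 + t\<^sup>2)\<close>. The
  decay is polynomial so that the gradient of the weight is at most \<open>e\<close> times the weight; a
  Gaussian would be integrable too, but its logarithmic gradient is unbounded.\<close>

definition weight :: "real \<Rightarrow> 'a::euclidean_space \<Rightarrow> real" where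
  "weight e x = (\<Prod>b\<in>Basis. inverse (1 + (e * (x \<bullet> b))\<^sup>2))"

definition weight_deriv :: "real \<Rightarrow> 'a::euclidean_space \<Rightarrow> 'a \<Rightarrow> real" where
  "weight_deriv e b x = - (2 * e\<^sup>2 * (x \<bullet> b)) / (1 + (e * (x \<bullet> b))\<^sup>2) * weight e x"

lemma one_plus_square_pos: "0 < 1 + (r::real)\<^sup>2"
  by (simp add: add_pos_nonneg)

lemma weight_pos: "0 < weight e x"
  unfolding weight_def by (intro prod_pos) (simp add: one_plus_square_pos)

lemma continuous_on_weight: "continuous_on S (weight e)"
  unfolding weight_def [abs_def]
  by (intro continuous_intros) (metis less_irrefl one_plus_square_pos)

lemma continuous_on_weight_deriv: "continuous_on S (weight_deriv e b)"
  unfolding weight_deriv_def [abs_def]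
  by (intro continuous_intros continuous_on_weight) (metis less_irrefl one_plus_square_pos)

lemma integrable_weight:
  assumes "e > 0"
  shows "integrable lborel (weight e :: 'a::euclidean_space \<Rightarrow> real)"
proof (rule integrableI_nonneg)
  show "weight e \<in> borel_measurable (lborel :: 'a measure)"
    using borel_measurable_continuous_onI[OF continuous_on_weight] by simp
  show "AE x in lborel. 0 \<le> weight e (x::'a)"
    by (simp add: weight_pos less_imp_le)
  have "integrable lborel (\<lambda>x::real. inverse (1 + x\<^sup>2))"
    using integrable_inverse_1_plus_square by (simp add: set_integrable_def einterval_def)
  then have i: "integrable lborel (\<lambda>x::real. inverse (1 + (e * x)\<^sup>2))"
    using lborel_integrable_real_affine[of "\<lambda>x::real. inverse (1 + x\<^sup>2)" e 0] assms by simp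
  have "(\<integral>\<^sup>+x. ennreal (inverse (1 + (e * x)\<^sup>2)) \<partial>lborel) < \<infinity>"
    using i by (simp add: integrable_iff_bounded)
  moreover have "(\<integral>\<^sup>+x. ennreal (weight e (x::'a)) \<partial>lborel) =
      (\<integral>\<^sup>+x. (\<Prod>b\<in>Basis. ennreal (inverse (1 + (e * ((x::'a) \<bullet> b))\<^sup>2))) \<partial>lborel)"
    unfolding weight_def by (subst prod_ennreal) auto
  moreover have "\<dots> = (\<Prod>b\<in>(Basis::'a set). (\<integral>\<^sup>+x. ennreal (inverse (1 + (e * x)\<^sup>2)) \<partial>lborel))"
    by (rule nn_integral_lborel_prod) auto
  ultimately show "(\<integral>\<^sup>+x. ennreal (weight e (x::'a)) \<partial>lborel) < \<infinity>"
    by (simp add: power_less_top_ennreal)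
qed

lemma weight_translate:
  fixes b :: "'a::euclidean_space"
  assumes "b \<in> Basis"
  shows "weight e (x + t *\<^sub>R b) =
    inverse (1 + (e * (x \<bullet> b + t))\<^sup>2) * (\<Prod>a\<in>Basis - {b}. inverse (1 + (e * (x \<bullet> a))\<^sup>2))"
proof -
  have "(\<Prod>a\<in>Basis - {b}. inverse (1 + (e * ((x + t *\<^sub>R b) \<bullet> a))\<^sup>2)) =
      (\<Prod>a\<in>Basis - {b}. inverse (1 + (e * (x \<bullet> a))\<^sup>2))"
    using assms by (intro prod.cong) (auto simp: inner_add_left inner_Basis)
  then show ?thesis
    unfolding weight_def using assms
    by (simp add: prod.remove[of Basis b] inner_add_left)
qed

lemma weight_has_derivative:
  fixes b :: "'a::euclidean_space"
  assumes "b \<in> Basis"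
  shows "((\<lambda>t. weight e (x + t *\<^sub>R b)) has_field_derivative weight_deriv e b x) (at 0)"
proof -
  let ?q = "\<lambda>t. 1 + (e * (x \<bullet> b + t))\<^sup>2"
  have "(?q has_field_derivative 2 * e\<^sup>2 * (x \<bullet> b)) (at 0)"
    by (auto intro!: derivative_eq_intros simp: power2_eq_square)
  moreover have "?q 0 \<noteq> 0"
    by (metis less_irrefl one_plus_square_pos)
  ultimately have "((\<lambda>t. inverse (?q t)) has_field_derivative
      - (inverse (?q 0) * (2 * e\<^sup>2 * (x \<bullet> b)) * inverse (?q 0))) (at 0)"
    by (rule DERIV_inverse')
  from DERIV_cmult_right[OF this, of "\<Prod>a\<in>Basis - {b}. inverse (1 + (e * (x \<bullet> a))\<^sup>2)"]
  show ?thesis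
    using weight_translate[OF assms, of e x 0]
    by (simp add: weight_translate[OF assms] weight_deriv_def divide_inverse mult_ac)
qed

lemma abs_weight_deriv_le:
  assumes "e \<ge> 0"
  shows "\<bar>weight_deriv e b x\<bar> \<le> e * weight e x"
proof -
  let ?r = "e * (x \<bullet> b)"
  have "2 * \<bar>?r\<bar> \<le> 1 + ?r\<^sup>2"
    using zero_le_power2[of "\<bar>?r\<bar> - 1"] by (simp add: power2_eq_square algebra_simps)
  then have "e * (2 * \<bar>?r\<bar>) \<le> e * (1 + ?r\<^sup>2)"
    using assms by (rule mult_left_mono)
  moreover have "e * (2 * \<bar>?r\<bar>) = \<bar>2 * e\<^sup>2 * (x \<bullet> b)\<bar>"
    using assms by (simp add: abs_mult power2_eq_square)
  ultimately have "\<bar>2 * e\<^sup>2 * (x \<bullet> b)\<bar> / (1 + ?r\<^sup>2) \<le> e"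
    by (simp add: pos_divide_le_eq one_plus_square_pos)
  then have "\<bar>2 * e\<^sup>2 * (x \<bullet> b)\<bar> / (1 + ?r\<^sup>2) * weight e x \<le> e * weight e x"
    by (rule mult_right_mono) (simp add: weight_pos less_imp_le)
  then show ?thesis
    unfolding weight_deriv_def
    by (simp add: abs_mult one_plus_square_pos weight_pos less_imp_le)
qed

text \<open>Translates by at most one unit are comparable to the weight. Hence, if a
  directional derivative is dominated by the weight, so are the difference quotients with steps of
  length at most one.\<close>

lemma weight_translate_le:
  fixes b :: "'a::euclidean_space"
  assumes "b \<in> Basis" "0 \<le> e" "e \<le> 1" "\<bar>s\<bar> \<le> 1"
  shows "weight e (x + s *\<^sub>R b) \<le> 4 * weight e x"
proof -
  define R where "R = (\<Prod>a\<in>Basis - {b}. inverse (1 + (e * (x \<bullet> a))\<^sup>2))"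
  have R: "R \<ge> 0"
    unfolding R_def by (intro prod_nonneg) (simp add: one_plus_square_pos less_imp_le)
  define p q where "p = e * (x \<bullet> b)" and "q = e * s"
  have "\<bar>q\<bar> \<le> 1"
    using assms by (simp add: q_def abs_mult mult_le_one)
  then have "q\<^sup>2 \<le> 1"
    by (simp add: abs_square_le_1)
  \<comment> \<open>This square is \<open>2 (p + q)\<^sup>2 + 2 q\<^sup>2 - p\<^sup>2\<close>.\<close>
  moreover have "0 \<le> (p + 2 * q)\<^sup>2"
    by simp
  ultimately have "1 + p\<^sup>2 \<le> 4 * (1 + (p + q)\<^sup>2)"
    using zero_le_power2[of "p + q"] by (simp add: power2_eq_square algebra_simps)
  then have "inverse (1 + (p + q)\<^sup>2) \<le> 4 * inverse (1 + p\<^sup>2)"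
    using one_plus_square_pos[of p] one_plus_square_pos[of "p + q"] by (simp add: field_simps)
  then have "inverse (1 + (p + q)\<^sup>2) * R \<le> 4 * inverse (1 + p\<^sup>2) * R"
    using R by (rule mult_right_mono)
  then show ?thesis
    using weight_translate[OF assms(1), of e x s] weight_translate[OF assms(1), of e x 0]
    by (simp add: R_def p_def q_def distrib_left)
qed

lemma integrable_weight_dominated:
  fixes F :: "'a::euclidean_space \<Rightarrow> real"
  assumes "e > 0" "continuous_on UNIV F" "\<And>x. \<bar>F x\<bar> \<le> C * weight e x"
  shows "integrable lborel F"
proof (rule Bochner_Integration.integrable_bound)
  show "integrable lborel (\<lambda>x::'a. C * weight e x)"
    by (intro integrable_mult_right integrable_weight assms)
  show "F \<in> borel_measurable lborel"
    using borel_measurable_continuous_onI[OF assms(2)] by simp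
qed (use assms(3) in \<open>auto intro: order_trans[OF _ abs_ge_self]\<close>)

text \<open>By translation invariance every difference quotient of \<open>F\<close> in direction \<open>b\<close> has integral
  \<open>0\<close>. The mean value theorem bounds these quotients by a multiple of the weight, and dominated
  convergence passes to the derivative.\<close>

lemma integral_directional_derivative_eq_0:
  fixes F F' :: "'a::euclidean_space \<Rightarrow> real"
  assumes b: "b \<in> Basis" and e: "0 < e" "e \<le> 1"
    and F: "continuous_on UNIV F" and F': "continuous_on UNIV F'"
    and d: "\<And>x. ((\<lambda>t. F (x + t *\<^sub>R b)) has_field_derivative F' x) (at 0)"
    and bF: "\<And>x. \<bar>F x\<bar> \<le> C * weight e x" and bF': "\<And>x. \<bar>F' x\<bar> \<le> C * weight e x"
  shows "(\<integral>x. F' x \<partial>lborel) = 0"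
proof -
  have C: "C \<ge> 0"
    using bF[of 0] weight_pos[of e "0::'a"]
    using zero_le_mult_iff[of C "weight e (0::'a)"] by linarith
  define r where "r n = inverse (real (Suc n))" for n
  define Q where "Q n x = (F (x + r n *\<^sub>R b) - F x) / r n" for n x
  have r: "0 < r n" "r n \<le> 1" for n
    by (simp_all add: r_def inverse_le_1_iff)
  have d': "((\<lambda>t. F (x + t *\<^sub>R b)) has_field_derivative F' (x + s *\<^sub>R b)) (at s)" for x s
    using d[of "x + s *\<^sub>R b"] DERIV_shift[of "\<lambda>t. F (x + t *\<^sub>R b)" _ 0 s]
    by (simp add: algebra_simps)
  have iF: "integrable lborel F"
    using integrable_weight_dominated e F bF by blast
  have tr: "integrable lborel (\<lambda>x. F (x + v))" "(\<integral>x. F (x + v) \<partial>lborel) = (\<integral>x. F x \<partial>lborel)" for v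
  proof -
    have m: "F \<in> borel_measurable borel"
      using F by (rule borel_measurable_continuous_onI)
    have "integrable (distr lborel borel ((+) v)) F"
      using iF by (simp add: lborel_distr_plus)
    then show "integrable lborel (\<lambda>x. F (x + v))"
      using m by (subst (asm) integrable_distr_eq) (auto simp: add.commute)
    have "(\<integral>x. F x \<partial>lborel) = (\<integral>x. F x \<partial>(distr lborel borel ((+) v)))"
      by (simp add: lborel_distr_plus)
    also have "\<dots> = (\<integral>x. F (x + v) \<partial>lborel)"
      using m by (subst integral_distr) (auto simp: add.commute)
    finally show "(\<integral>x. F (x + v) \<partial>lborel) = (\<integral>x. F x \<partial>lborel)" ..
  qed
  have "(\<lambda>n. \<integral>x. Q n x \<partial>lborel) \<longlonglongrightarrow> (\<integral>x. F' x \<partial>lborel)"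
  proof (rule integral_dominated_convergence)
    show "F' \<in> borel_measurable lborel"
      using borel_measurable_continuous_onI[OF F'] by simp
    show "Q n \<in> borel_measurable lborel" for n
      unfolding Q_def [abs_def]
      by (intro borel_measurable_integrable integrable_divide_zero
          Bochner_Integration.integrable_diff tr iF)
    show "integrable lborel (\<lambda>x::'a. C * (4 * weight e x))"
      by (intro integrable_mult_right integrable_weight e)
    show "AE x in lborel. (\<lambda>n. Q n x) \<longlonglongrightarrow> F' x"
    proof (rule AE_I2)
      fix x
      have "((\<lambda>h. (F (x + h *\<^sub>R b) - F x) / h) \<longlongrightarrow> F' x) (at 0)"
        using d[of x] by (simp add: DERIV_def)
      moreover have "filterlim r (at 0) sequentially"
        unfolding filterlim_at r_def
        using LIMSEQ_inverse_real_of_nat by auto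
      ultimately show "(\<lambda>n. Q n x) \<longlonglongrightarrow> F' x"
        unfolding Q_def by (rule filterlim_compose)
    qed
    show "AE x in lborel. norm (Q n x) \<le> C * (4 * weight e x)" for n
    proof (rule AE_I2)
      fix x
      obtain z where z: "0 < z" "z < r n"
        "F (x + r n *\<^sub>R b) - F (x + 0 *\<^sub>R b) = (r n - 0) * F' (x + z *\<^sub>R b)"
        using MVT2[OF r(1)[of n], of "\<lambda>t. F (x + t *\<^sub>R b)" "\<lambda>s. F' (x + s *\<^sub>R b)"] d' by blast
      then have "Q n x = F' (x + z *\<^sub>R b)"
        using r(1)[of n] by (simp add: Q_def)
      also have "norm \<dots> \<le> C * weight e (x + z *\<^sub>R b)"
        using bF' by simp
      also have "\<dots> \<le> C * (4 * weight e x)"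
        using z r[of n] by (intro mult_left_mono C weight_translate_le b) (use e in auto)
      finally show "norm (Q n x) \<le> C * (4 * weight e x)" .
    qed
  qed
  moreover have "(\<integral>x. Q n x \<partial>lborel) = 0" for n
    using tr iF by (simp add: Q_def)
  ultimately show ?thesis
    by (simp add: LIMSEQ_const_iff)
qed

section \<open>Weighted energies\<close>

definition wprod :: "real \<Rightarrow> ('a::euclidean_space \<Rightarrow> real) \<Rightarrow> ('a \<Rightarrow> real) \<Rightarrow> real" where
  "wprod e f g = (\<integral>x. weight e x * (f x * g x) \<partial>lborel)"

definition wgrad :: "real \<Rightarrow> (real ^ 'n::finite \<Rightarrow> real) \<Rightarrow> (real ^ 'n \<Rightarrow> real) \<Rightarrow> real" where
  "wgrad e f g = (\<Sum>i\<in>UNIV. wprod e (partial i f) (partial i g))"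

text \<open>The square of the weighted first order Sobolev norm.\<close>

definition energy :: "real \<Rightarrow> (real ^ 'n::finite \<Rightarrow> real) \<Rightarrow> real" where
  "energy e f = wprod e f f + wgrad e f f"

lemma wprod_commute: "wprod e f g = wprod e g f"
  by (simp add: wprod_def mult.commute)

lemma wgrad_commute: "wgrad e f g = wgrad e g f"
  by (simp add: wgrad_def wprod_commute)

lemma wprod_self_nonneg: "0 \<le> wprod e f f"
  unfolding wprod_def by (simp add: weight_pos less_imp_le)

lemma wgrad_self_nonneg: "0 \<le> wgrad e f f"
  unfolding wgrad_def by (simp add: sum_nonneg wprod_self_nonneg)

lemma bounded_mult_range:
  fixes f g :: "'a \<Rightarrow> real"
  assumes "bounded (range f)" "bounded (range g)"
  obtains C where "C \<ge> 0" "\<And>x. \<bar>f x * g x\<bar> \<le> C"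
proof -
  obtain A B where "\<And>x. \<bar>f x\<bar> \<le> A" "\<And>x. \<bar>g x\<bar> \<le> B"
    using assms by (auto simp: bounded_iff)
  then have "\<bar>f x * g x\<bar> \<le> A * B" for x
    by (metis abs_ge_zero abs_mult mult_mono order_trans)
  then show thesis
    using that[of "A * B"] abs_ge_zero order_trans by blast
qed

lemma integrable_wprod:
  fixes f g :: "'a::euclidean_space \<Rightarrow> real"
  assumes "e > 0" "continuous_on UNIV f" "continuous_on UNIV g"
    "bounded (range f)" "bounded (range g)"
  shows "integrable lborel (\<lambda>x. weight e x * (f x * g x))"
proof -
  obtain C where C: "\<And>x. \<bar>f x * g x\<bar> \<le> C"
    using bounded_mult_range[OF assms(4,5)] by blast
  show ?thesis
  proof (rule integrable_weight_dominated[OF assms(1)])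
    show "continuous_on UNIV (\<lambda>x. weight e x * (f x * g x))"
      by (intro continuous_intros continuous_on_weight assms)
    show "\<bar>weight e x * (f x * g x)\<bar> \<le> C * weight e x" for x
      using mult_left_mono[OF C[of x], of "weight e x"] weight_pos[of e x]
      by (simp add: abs_mult mult.commute)
  qed
qed

lemma two_wprod_le:
  assumes "e > 0" "continuous_on UNIV f" "continuous_on UNIV g"
    "bounded (range f)" "bounded (range g)"
  shows "2 * wprod e f g \<le> wprod e f f + wprod e g g"
proof -
  note i = integrable_wprod[OF assms(1,2,2,4,4)] integrable_wprod[OF assms(1,3,3,5,5)]
    integrable_wprod[OF assms]
  have "(\<integral>x. weight e x * (f x * f x) + weight e x * (g x * g x) - 2 * (weight e x * (f x * g x)) \<partial>lborel)
      = wprod e f f + wprod e g g - 2 * wprod e f g"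
    unfolding wprod_def using i by simp
  moreover have "weight e x * (f x * f x) + weight e x * (g x * g x) - 2 * (weight e x * (f x * g x))
      = weight e x * (f x - g x)\<^sup>2" for x
    by (simp add: power2_eq_square algebra_simps)
  moreover have "0 \<le> (\<integral>x. weight e x * (f x - g x)\<^sup>2 \<partial>lborel)"
    by (intro Bochner_Integration.integral_nonneg) (simp add: weight_pos less_imp_le)
  ultimately show ?thesis
    by simp
qed

text \<open>Integrating the derivative of \<open>weight * \<partial>\<^sub>i f * g\<close> gives zero. The two terms on the left come
  from differentiating \<open>\<partial>\<^sub>i f\<close> and \<open>g\<close>; the remaining one, with the derivative of the weight, is
  small of order \<open>e\<close> because of the bound \<open>abs_weight_deriv_le\<close>.\<close>

lemma weighted_integration_by_parts_coordinate:
  fixes f g :: "real ^ 'n::finite \<Rightarrow> real"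
  assumes e: "0 < e" "e \<le> 1"
    and f: "bounded_partials 2 f" and g: "bounded_partials 1 g"
  shows "\<bar>wprod e (partial i (partial i f)) g + wprod e (partial i f) (partial i g)\<bar>
    \<le> e * (wprod e (partial i f) (partial i f) + wprod e g g)"
proof -
  let ?f1 = "partial i f" and ?f2 = "partial i (partial i f)" and ?g1 = "partial i g"
  let ?w = "weight e :: real ^ 'n \<Rightarrow> real"
  let ?w1 = "weight_deriv e (ax i)"
  have sm: "smooth ?f1" "smooth ?f2" "smooth g" "smooth ?g1"
    using f g bounded_partials_smooth smooth_partial by blast+
  note co = sm[THEN smooth_imp_continuous]
  have bd: "bounded (range ?f1)" "bounded (range ?f2)" "bounded (range g)" "bounded (range ?g1)"
    using f g by (auto simp: numeral_2_eq_2)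
  note int = integrable_wprod[OF e(1)]
  have ax: "ax i \<in> Basis"
    by simp
  obtain C0 where C0: "C0 \<ge> 0" "\<And>x. \<bar>?f1 x * g x\<bar> \<le> C0"
    using bounded_mult_range[OF bd(1,3)] by blast
  obtain C1 where C1: "C1 \<ge> 0" "\<And>x. \<bar>?f2 x * g x\<bar> \<le> C1"
    using bounded_mult_range[OF bd(2,3)] by blast
  obtain C2 where C2: "C2 \<ge> 0" "\<And>x. \<bar>?f1 x * ?g1 x\<bar> \<le> C2"
    using bounded_mult_range[OF bd(1,4)] by blast
  let ?F = "\<lambda>x. ?w x * (?f1 x * g x)"
  let ?D = "\<lambda>x. ?w x * (?f2 x * g x) + ?w x * (?f1 x * ?g1 x)"
  let ?E = "\<lambda>x. ?w1 x * (?f1 x * g x)"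
  have wb: "\<bar>?w x * y\<bar> \<le> K * ?w x" if "\<bar>y\<bar> \<le> K" for x y K
    using mult_left_mono[OF that, of "?w x"] weight_pos[of e x] by (simp add: abs_mult mult.commute)
  have w1: "\<bar>?w1 x\<bar> \<le> ?w x" for x
    using order_trans[OF abs_weight_deriv_le[of e "ax i" x], of "?w x"] e weight_pos[of e x]
    by simp
  have Eb: "\<bar>?E x\<bar> \<le> C0 * ?w x" for x
    using mult_mono[OF w1[of x] C0(2)[of x]] weight_pos[of e x] by (simp add: abs_mult mult.commute)
  have cE: "continuous_on UNIV ?E"
    by (intro continuous_intros continuous_on_weight_deriv co)
  have "(\<integral>x. ?E x + ?D x \<partial>lborel) = 0"
  proof (rule integral_directional_derivative_eq_0[OF ax e, where F = ?F and C = "C0 + C1 + C2"])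
    show "continuous_on UNIV ?F"
      by (intro continuous_intros continuous_on_weight co)
    show "continuous_on UNIV (\<lambda>x. ?E x + ?D x)"
      by (intro continuous_intros cE continuous_on_weight co)
    show "((\<lambda>t. ?F (x + t *\<^sub>R ax i)) has_field_derivative ?E x + ?D x) (at 0)" for x
      using DERIV_mult[OF weight_has_derivative[OF ax, of e x]
          DERIV_mult[OF smooth_has_partial_derivative_0[OF sm(1), of x i]
            smooth_has_partial_derivative_0[OF sm(3), of x i]]]
      by (simp add: algebra_simps)
    show "\<bar>?F x\<bar> \<le> (C0 + C1 + C2) * ?w x" for x
      using C0(2)[of x] C1(1) C2(1) by (intro wb) linarith
    show "\<bar>?E x + ?D x\<bar> \<le> (C0 + C1 + C2) * ?w x" for x
      using Eb[of x] wb[OF C1(2)[of x], of x] wb[OF C2(2)[of x], of x]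
      by (simp add: distrib_right)
  qed
  moreover have iE: "integrable lborel ?E"
    by (rule integrable_weight_dominated[OF e(1) cE Eb])
  moreover have iD: "integrable lborel ?D"
    by (intro Bochner_Integration.integrable_add int co bd)
  moreover have "(\<integral>x. ?D x \<partial>lborel) = wprod e ?f2 g + wprod e ?f1 ?g1"
    unfolding wprod_def by (intro Bochner_Integration.integral_add int co bd)
  ultimately have "\<bar>wprod e ?f2 g + wprod e ?f1 ?g1\<bar> = \<bar>\<integral>x. ?E x \<partial>lborel\<bar>"
    by simp
  also have "\<dots> \<le> (\<integral>x. e * (?w x * (?f1 x * ?f1 x) + ?w x * (g x * g x)) \<partial>lborel)"
  proof (rule integral_abs_bound_integral)
    show "integrable lborel (\<lambda>x. e * (?w x * (?f1 x * ?f1 x) + ?w x * (g x * g x)))"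
      by (intro integrable_mult_right Bochner_Integration.integrable_add int co bd)
    show "\<bar>?E x\<bar> \<le> e * (?w x * (?f1 x * ?f1 x) + ?w x * (g x * g x))" for x
    proof -
      have "2 * \<bar>?f1 x * g x\<bar> \<le> ?f1 x * ?f1 x + g x * g x"
        using zero_le_power2[of "\<bar>?f1 x\<bar> - \<bar>g x\<bar>"]
        by (simp add: power2_eq_square algebra_simps abs_mult)
      then have "\<bar>?f1 x * g x\<bar> \<le> ?f1 x * ?f1 x + g x * g x"
        by simp
      then have "\<bar>?w1 x\<bar> * \<bar>?f1 x * g x\<bar> \<le> (e * ?w x) * (?f1 x * ?f1 x + g x * g x)"
        using abs_weight_deriv_le[of e "ax i" x] e weight_pos[of e x] by (intro mult_mono) auto
      then show ?thesis
        by (simp add: abs_mult algebra_simps)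
    qed
  qed (rule iE)
  also have "\<dots> = e * (wprod e ?f1 ?f1 + wprod e g g)"
    unfolding wprod_def
    by (simp add: Bochner_Integration.integral_add int co bd)
  finally show ?thesis .
qed

lemma wprod_neg_laplacian:
  fixes f g :: "real ^ 'n::finite \<Rightarrow> real"
  assumes "0 < e" "bounded_partials 2 f" "bounded_partials 0 g"
  shows "wprod e (neg_laplacian f) g = - (\<Sum>i\<in>UNIV. wprod e (partial i (partial i f)) g)"
proof -
  let ?h = "\<lambda>i x. weight e x * (partial i (partial i f) x * g x)"
  have "smooth f" "smooth g"
    using assms bounded_partials_smooth by blast+
  moreover have "bounded (range (partial i (partial i f)))" "bounded (range g)" for i
    using assms by (auto simp: numeral_2_eq_2)
  ultimately have i: "integrable lborel (?h i)" for i
    using assms(1) by (intro integrable_wprod smooth_imp_continuous smooth_partial)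
  have "weight e x * (neg_laplacian f x * g x) = - (\<Sum>i\<in>UNIV. ?h i x)" for x
    by (simp add: neg_laplacian_eq sum_distrib_left sum_distrib_right)
  then have "wprod e (neg_laplacian f) g = - (\<integral>x. (\<Sum>i\<in>UNIV. ?h i x) \<partial>lborel)"
    by (simp add: wprod_def)
  also have "(\<integral>x. (\<Sum>i\<in>UNIV. ?h i x) \<partial>lborel) = (\<Sum>i\<in>UNIV. \<integral>x. ?h i x \<partial>lborel)"
    by (intro Bochner_Integration.integral_sum i)
  finally show ?thesis
    by (simp add: wprod_def)
qed

text \<open>Up to an error of order \<open>e\<close> relative to the energies, the negative Laplacian is the symmetric
  nonnegative operator given by the Dirichlet form.\<close>

lemma weighted_integration_by_parts:
  fixes f g :: "real ^ 'n::finite \<Rightarrow> real"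
  assumes e: "0 < e" "e \<le> 1"
    and f: "bounded_partials 2 f" and g: "bounded_partials 1 g"
  shows "\<bar>wprod e (neg_laplacian f) g - wgrad e f g\<bar> \<le> e * CARD('n) * (energy e f + energy e g)"
proof -
  have "wprod e (neg_laplacian f) g - wgrad e f g =
      - (\<Sum>i\<in>UNIV. wprod e (partial i (partial i f)) g + wprod e (partial i f) (partial i g))"
    using bounded_partials_mono[OF g, of 0]
    by (simp add: wprod_neg_laplacian e f wgrad_def sum.distrib)
  also have "\<bar>\<dots>\<bar> \<le> (\<Sum>i\<in>UNIV. e * (wprod e (partial i f) (partial i f) + wprod e g g))"
    unfolding abs_minus_cancel
    by (intro order_trans[OF sum_abs] sum_mono weighted_integration_by_parts_coordinate assms)
  also have "\<dots> = e * (wgrad e f f + CARD('n) * wprod e g g)"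
    unfolding sum_distrib_left[symmetric] by (simp add: wgrad_def sum.distrib)
  also have "\<dots> \<le> e * (CARD('n) * (energy e f + energy e g))"
  proof (intro mult_left_mono)
    have "1 \<le> real CARD('n)"
      by (simp add: Suc_leI)
    from mult_right_mono[OF this wgrad_self_nonneg[of e f]]
    have "wgrad e f f \<le> CARD('n) * wgrad e f f"
      by simp
    also have "\<dots> \<le> CARD('n) * (energy e f + wgrad e g g)"
      using wprod_self_nonneg[of e f] wgrad_self_nonneg[of e g]
      by (intro mult_left_mono) (auto simp: energy_def)
    finally show "wgrad e f f + CARD('n) * wprod e g g \<le> CARD('n) * (energy e f + energy e g)"
      by (simp add: energy_def algebra_simps)
  qed (use e in simp)
  finally show ?thesis
    by (simp add: mult.assoc)
qed

section \<open>Almost symmetric nonnegative forms\<close>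

text \<open>The algebraic core. Think of \<open>B i j\<close> as the inner product of \<open>L\<^sup>i w\<close> and \<open>L\<^sup>j w\<close>, where \<open>L\<close> is
  symmetric with Dirichlet form \<open>G\<close> up to a relative error \<open>c\<close>. Moving half of the operators to the
  other side shows that \<open>\<langle>L\<^sup>i v, v\<rangle>\<close> is nearly \<open>\<parallel>L\<^sup>k v\<parallel>\<^sup>2\<close> for \<open>i = 2 k\<close> and nearly the Dirichlet energy of
  \<open>L\<^sup>k v\<close> for \<open>i = 2 k + 1\<close>, so it is nearly nonnegative. If the sum over \<open>i < m\<close> vanishes, its
  \<open>i = 0\<close> term \<open>\<parallel>v\<parallel>\<^sup>2\<close> is therefore bounded by the error. Periodicity makes the total energy \<open>T\<close> over
  one period a common bound for all errors; adding the estimates for \<open>v = L\<^sup>j w\<close>, \<open>j < m\<close>, bounds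
  \<open>T\<close> by \<open>6 m\<^sup>3 c T\<close>, which forces \<open>T = 0\<close> when the factor is less than \<open>1\<close>.\<close>

lemma almost_symmetric_energy_bound:
  fixes B G :: "nat \<Rightarrow> nat \<Rightarrow> real" and c :: real and m :: nat
  defines "N \<equiv> \<lambda>i. B i i + G i i"
  assumes Bsym: "\<And>i j. B i j = B j i" and Gsym: "\<And>i j. G i j = G j i"
    and Bpos: "\<And>i. 0 \<le> B i i" and Gpos: "\<And>i. 0 \<le> G i i"
    and BB: "\<And>i j. 2 * B i j \<le> B i i + B j j"
    and parts: "\<And>i j. \<bar>B (Suc i) j - G i j\<bar> \<le> c * (N i + N j)"
    and per: "\<And>i. N (i + m) = N i"
    and sum0: "\<And>j. (\<Sum>i<m. B (j + i) j) = 0"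
    and m: "m \<ge> 1" and c: "0 \<le> c" "6 * real m ^ 3 * c < 1"
  shows "N j = 0"
proof -
  define T where "T = (\<Sum>i<m. N i)"
  define d where "d = 2 * c * T"
  have Npos: "0 \<le> N i" for i
    using Bpos Gpos by (simp add: N_def)
  have T: "0 \<le> T"
    unfolding T_def by (intro sum_nonneg Npos)
  have d: "0 \<le> d"
    using T c by (simp add: d_def)
  have per': "N i = N (i mod m)" for i
  proof -
    have "N (r + k * m) = N r" for r k
      by (induction k) (simp, metis per add.assoc add.commute mult_Suc)
    from this[of "i mod m" "i div m"] show ?thesis by simp
  qed
  have NT: "N i \<le> T" for i
    unfolding per'[of i] T_def using m Npos by (intro member_le_sum) auto
  have p1: "\<bar>B (Suc i) j - G i j\<bar> \<le> d" for i j
  proof -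
    have "c * (N i + N j) \<le> c * (T + T)"
      using NT c by (intro mult_left_mono add_mono) auto
    then show ?thesis
      using parts[of i j] by (simp add: d_def)
  qed
  have p2: "\<bar>B (Suc a) b - B a (Suc b)\<bar> \<le> 2 * d" for a b
    using p1[of a b] p1[of b a] Bsym[of a "Suc b"] Gsym[of a b] by linarith
  have p3: "\<bar>B (a + k) b - B a (b + k)\<bar> \<le> 2 * real k * d" for a b k
  proof (induction k arbitrary: b)
    case (Suc k)
    have "\<bar>B (a + Suc k) b - B (a + k) (Suc b)\<bar> \<le> 2 * d"
      using p2[of "a + k" b] by simp
    moreover have "\<bar>B (a + k) (Suc b) - B a (Suc b + k)\<bar> \<le> 2 * real k * d"
      by (rule Suc)
    ultimately show ?case
      by (simp add: algebra_simps)
  qed simp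
  have low: "- (real i * d) \<le> B (j + i) j" for i j
  proof (cases "even i")
    case True
    then obtain k where k: "i = k + k" by (metis evenE mult_2)
    have "B (j + k) (j + k) - 2 * real k * d \<le> B (j + i) j"
      using p3[of "j + k" k j] by (simp add: k add.assoc)
    then show ?thesis
      using Bpos[of "j + k"] by (simp add: k algebra_simps)
  next
    case False
    then obtain k where k: "i = Suc (k + k)" by (metis oddE mult_2 Suc_eq_plus1)
    have "B (Suc (j + k)) (j + k) - 2 * real k * d \<le> B (j + i) j"
      using p3[of "Suc (j + k)" k j] by (simp add: k add.assoc)
    then show ?thesis
      using Gpos[of "j + k"] p1[of "j + k" "j + k"] by (simp add: k algebra_simps)
  qed
  have m1: "1 \<le> real m ^ 2"
    using m by simp
  have Nd: "N j \<le> 3 * real m ^ 2 * d" for j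
  proof -
    have Bd: "B j j \<le> real m ^ 2 * d" for j
    proof -
      have "B j j + (\<Sum>i\<in>{..<m} - {0}. B (j + i) j) = 0"
        using sum0[of j] m by (subst (asm) sum.remove[of _ 0]) auto
      moreover have "(\<Sum>i\<in>{..<m} - {0}. - (real m * d)) \<le> (\<Sum>i\<in>{..<m} - {0}. B (j + i) j)"
      proof (rule sum_mono)
        fix i
        assume "i \<in> {..<m} - {0}"
        then have "real i * d \<le> real m * d"
          using d by (intro mult_right_mono) auto
        then show "- (real m * d) \<le> B (j + i) j"
          using low[of i j] by linarith
      qed
      moreover have "real (card ({..<m} - {0})) * (real m * d) \<le> real m * (real m * d)"
        using d card_mono[of "{..<m}" "{..<m} - {0}"] by (intro mult_right_mono) auto
      ultimately show ?thesis
        by (simp add: power2_eq_square)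
    qed
    have "G j j \<le> B (Suc j) j + d"
      using p1[of j j] by linarith
    then have "G j j \<le> real m ^ 2 * d + d"
      using BB[of "Suc j" j] Bd[of j] Bd[of "Suc j"] by linarith
    moreover have "d \<le> real m ^ 2 * d"
      using mult_right_mono[OF m1 d] by simp
    ultimately show ?thesis
      using Bd[of j] by (simp add: N_def)
  qed
  have "T \<le> (\<Sum>i<m. 3 * real m ^ 2 * d)"
    unfolding T_def by (intro sum_mono Nd)
  also have "\<dots> = (6 * real m ^ 3 * c) * T"
    by (simp add: d_def power2_eq_square power3_eq_cube)
  finally have "T * (1 - 6 * real m ^ 3 * c) \<le> 0"
    by (simp add: algebra_simps)
  then have "T \<le> 0"
    using c by (simp add: mult_le_0_iff)
  then show ?thesis
    using NT[of j] Npos[of j] by linarith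
qed

section \<open>Periodic chains of functions under the Laplacian\<close>

lemma continuous_AE_le_imp_le:
  fixes f :: "'a::euclidean_space \<Rightarrow> real"
  assumes "continuous_on UNIV f" "AE x in lebesgue. f x \<le> C"
  shows "f x \<le> C"
proof (rule ccontr)
  assume "\<not> f x \<le> C"
  let ?S = "{x. C < f x}"
  have "open ?S"
    using open_Collect_less[OF continuous_on_const assms(1)] .
  moreover have "?S \<noteq> {}"
    using \<open>\<not> f x \<le> C\<close> not_le by blast
  ultimately have "\<not> negligible ?S"
    by (rule open_not_negligible)
  moreover have "?S \<in> null_sets lebesgue"
  proof -
    have "AE x in lebesgue. x \<notin> ?S"
      using assms(2) by eventually_elim simp
    moreover have "?S \<in> sets lebesgue"
      using \<open>open ?S\<close> by simp
    ultimately show ?thesis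
      by (simp add: AE_iff_null_sets)
  qed
  ultimately show False
    by (simp add: negligible_iff_null_sets)
qed

lemma wprod_self_eq_0_imp:
  assumes "e > 0" "continuous_on UNIV f" "bounded (range f)" "wprod e f f = 0"
  shows "f x = 0"
proof -
  have "AE x in lborel. weight e x * (f x * f x) = 0"
    using assms integrable_wprod[of e f f]
    unfolding wprod_def
    by (subst (asm) integral_nonneg_eq_0_iff_AE) (auto simp: weight_pos less_imp_le)
  then have "AE x in lborel. \<bar>f x\<bar> \<le> 0"
    
  proof eventually_elim
    case (elim x)
    then show ?case
      using weight_pos[of e x] by simp
  qed
  then have "AE x in lebesgue. \<bar>f x\<bar> \<le> 0"
    by (rule AE_completion)
  then have "\<bar>f x\<bar> \<le> 0"
    by (intro continuous_AE_le_imp_le[of "\<lambda>x. \<bar>f x\<bar>"] continuous_intros assms(2))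
  then show ?thesis by simp
qed

text \<open>Because the \<open>f j\<close> are bounded with their derivatives, the weighted integrals converge for every
  \<open>e > 0\<close>. Choosing \<open>e\<close> small in terms of \<open>m\<close> and the dimension brings the error of integration by
  parts below the threshold of \<open>almost_symmetric_energy_bound\<close>.\<close>

lemma periodic_chain_vanishes:
  fixes f :: "nat \<Rightarrow> real ^ 'n::finite \<Rightarrow> real"
  assumes bd: "\<And>j. bounded_partials 2 (f j)"
    and step: "\<And>j. neg_laplacian (f j) = f (Suc j)"
    and per: "\<And>j. f (j + m) = f j"
    and sum0: "\<And>j x. (\<Sum>i<m. f (j + i) x) = 0"
    and m: "m \<ge> 1"
  shows "f j x = 0"
proof -
  \<comment> \<open>The relative error of integration by parts is \<open>e * CARD('n)\<close>, so \<open>K * e < 1\<close> is needed.\<close>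
  define K where "K = 6 * real m ^ 3 * real CARD('n)"
  define e where "e = 1 / (K + 1)"
  have K: "0 \<le> K"
    by (simp add: K_def)
  have e: "0 < e" "e \<le> 1" "K * e < 1"
    using K by (auto simp: e_def field_simps)
  have co: "continuous_on UNIV (f j)" and br: "bounded (range (f j))" for j
    using bd bounded_partials_smooth smooth_imp_continuous bounded_partials_bounded by blast+
  have bd1: "bounded_partials 1 (f j)" for j
    using bounded_partials_mono[OF bd, of 1 j] by simp
  define B where "B i j = wprod e (f i) (f j)" for i j
  define G where "G i j = wgrad e (f i) (f j)" for i j
  have "B j j + G j j = 0"
  proof (rule almost_symmetric_energy_bound[where B = B and G = G and j = j and m = m and c = "e * CARD('n)"])
    show "B i j = B j i" "G i j = G j i" for i j
      unfolding B_def G_def by (rule wprod_commute wgrad_commute)+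
    show "0 \<le> B i i" "0 \<le> G i i" for i
      unfolding B_def G_def by (rule wprod_self_nonneg wgrad_self_nonneg)+
    show "2 * B i j \<le> B i i + B j j" for i j
      unfolding B_def by (intro two_wprod_le e co br)
    show "\<bar>B (Suc i) j - G i j\<bar> \<le> e * CARD('n) * (B i i + G i i + (B j j + G j j))" for i j
      using weighted_integration_by_parts[OF e(1,2) bd bd1, of i j]
      by (simp add: B_def G_def step energy_def)
    show "B (i + m) (i + m) + G (i + m) (i + m) = B i i + G i i" for i
      by (simp add: B_def G_def per)
    show "(\<Sum>i<m. B (j + i) j) = 0" for j
    proof -
      have "(\<Sum>i<m. B (j + i) j) = (\<integral>x. (\<Sum>i<m. weight e x * (f (j + i) x * f j x)) \<partial>lborel)"
        unfolding B_def wprod_def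
        by (intro Bochner_Integration.integral_sum[symmetric] integrable_wprod e co br)
      also have "\<dots> = (\<integral>x. weight e x * ((\<Sum>i<m. f (j + i) x) * f j x) \<partial>lborel)"
        by (simp add: sum_distrib_left sum_distrib_right)
      finally show ?thesis by (simp add: sum0)
    qed
    show "0 \<le> e * CARD('n)" "6 * real m ^ 3 * (e * CARD('n)) < 1"
      using e by (simp_all add: K_def mult_ac)
  qed (rule m)
  then have "B j j = 0"
    using wprod_self_nonneg[of e "f j"] wgrad_self_nonneg[of e "f j"] by (simp add: B_def G_def)
  then show ?thesis
    unfolding B_def by (rule wprod_self_eq_0_imp[OF e(1) co br])
qed

section \<open>Bounded eigenfunctions of powers of the Laplacian\<close>

text \<open>For a continuous function the essential bound holds everywhere, since a nonempty open set is
  not negligible.\<close>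

lemma L_infinity_imp_bounded:
  assumes "continuous_on UNIV u" "L_infinity u"
  shows "bounded (range u)"
proof -
  have "esssup lebesgue (\<lambda>x. ereal \<bar>u x\<bar>) < \<infinity>"
    using assms(2) by (simp add: L_infinity_def)
  then obtain n :: nat where n: "esssup lebesgue (\<lambda>x. ereal \<bar>u x\<bar>) < ereal (real n)"
    using less_PInf_Ex_of_nat by (metis less_irrefl)
  have "AE x in lebesgue. ereal \<bar>u x\<bar> \<le> esssup lebesgue (\<lambda>x. ereal \<bar>u x\<bar>)"
    by (rule esssup_AE)
  then have "AE x in lebesgue. \<bar>u x\<bar> \<le> real n"
    by eventually_elim (use n in \<open>meson ereal_less_eq(3) less_imp_le order_trans\<close>)
  then have "\<bar>u x\<bar> \<le> real n" for x
    by (intro continuous_AE_le_imp_le[of "\<lambda>x. \<bar>u x\<bar>"] continuous_intros assms(1))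
  then show ?thesis
    by (auto simp: bounded_iff)
qed

text \<open>The differences \<open>L\<^sup>j\<^sup>+\<^sup>1 u - L\<^sup>j u\<close> form a chain of period \<open>m\<close> whose sum over a period telescopes
  to zero. Second derivatives of all \<open>L\<^sup>j u\<close> must be bounded; by periodicity it is enough to look at
  \<open>j < m\<close>, and there they are derivatives of \<open>u\<close> of order at most \<open>2 m\<close>.\<close>

lemma polyharmonic_eigenfunction_many_bounded_partials:
  assumes u: "bounded_partials (2 * m) u" and m: "m \<ge> 1"
    and eq: "(neg_laplacian ^^ m) u = u"
  shows "neg_laplacian u = u"
proof -
  define U where "U j = (neg_laplacian ^^ j) u" for j
  have per: "U (j + m) = U j" for j
    by (simp add: U_def funpow_add eq)
  have sm: "smooth (U j)" for j
    using u bounded_partials_smooth smooth_neg_laplacian_funpow unfolding U_def by blast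
  have bd: "bounded_partials 2 (U j)" for j
  proof -
    have "U (r + k * m) = U r" for r k
      by (induction k) (simp, metis per add.assoc add.commute mult_Suc)
    from this[of "j mod m" "j div m"] have "U j = U (j mod m)" by simp
    moreover have "bounded_partials 2 (U (j mod m))"
    proof -
      have "j mod m < m"
        using m by simp
      then have "2 * (j mod m) + 2 \<le> 2 * m"
        by linarith
      then show ?thesis
        unfolding U_def
        by (intro bounded_partials_neg_laplacian_funpow bounded_partials_mono[OF u])
    qed
    ultimately show ?thesis by simp
  qed
  define f where "f j = (\<lambda>x. U (Suc j) x - U j x)" for j
  have "f 0 x = 0" for x
  proof (rule periodic_chain_vanishes[OF _ _ _ _ m])
    show "bounded_partials 2 (f j)" for j
      unfolding f_def by (intro bounded_partials_diff bd)
    show "neg_laplacian (f j) = f (Suc j)" for j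
      unfolding f_def by (subst neg_laplacian_diff) (auto simp: sm, simp add: U_def)
    show "f (j + m) = f j" for j
      using per[of j] per[of "Suc j"] by (simp add: f_def)
    show "(\<Sum>i<m. f (j + i) x) = 0" for j x
      using sum_lessThan_telescope[of "\<lambda>i. U (j + i) x" m] per[of j] by (simp add: f_def)
  qed
  then show ?thesis
    by (simp add: f_def U_def fun_eq_iff)
qed

text \<open>Downward induction on \<open>k\<close>. Averaging over all coordinate directions preserves the equation and
  makes one more order of derivatives bounded, so the averages of \<open>u\<close> are already known to satisfy
  \<open>L v = v\<close>. The averages of \<open>L u\<close> and of \<open>u\<close> thus coincide for all lengths of the segments, and
  these averages determine the functions.\<close>

lemma polyharmonic_eigenfunction:
  fixes u :: "real ^ 'n::finite \<Rightarrow> real"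
  assumes "bounded_partials k u" "m \<ge> 1" "(neg_laplacian ^^ m) u = u"
  shows "neg_laplacian u = u"
proof (cases "k \<le> 2 * m")
  case False
  then show ?thesis
    using assms polyharmonic_eigenfunction_many_bounded_partials bounded_partials_mono
    by (metis linear)
next
  case True
  then show ?thesis
    using assms(1,3)
  proof (induction k arbitrary: u rule: inc_induct)
    case base
    then show ?case
      using polyharmonic_eigenfunction_many_bounded_partials assms(2) by blast
  next
    case (step k)
    have sm: "smooth u"
      using step.prems bounded_partials_smooth by blast
    obtain "is" :: "'n list" where "is": "set is = UNIV"
      using finite_list[OF finite_class.finite_UNIV] by blast
    show ?case
    proof (rule averages_inject)
      fix ps :: "('n \<times> real) list"
      assume ps: "map fst ps = is" "\<forall>p\<in>set ps. snd p > 0"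
      have "bounded_partials (Suc k) (averages ps u)"
        using ps "is" by (intro bounded_partials_Suc_averages step.prems) (force simp flip: set_map)+
      moreover have "(neg_laplacian ^^ m) (averages ps u) = averages ps u"
        by (simp add: neg_laplacian_funpow_averages sm step.prems)
      ultimately have "neg_laplacian (averages ps u) = averages ps u"
        by (rule step.IH)
      then show "averages ps (neg_laplacian u) = averages ps u"
        by (simp add: neg_laplacian_averages sm)
    qed (intro smooth_imp_continuous smooth_neg_laplacian sm)+
  qed
qed

theorem theorem1p3:
  fixes u :: "real ^ 'n \<Rightarrow> real" and m :: nat
  assumes "smooth u" and "L_infinity u" and "m \<ge> 1"
  shows "(\<forall>x. (neg_laplacian ^^ m) u x = u x) \<longleftrightarrow> (\<forall>x. neg_laplacian u x = u x)"
proof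
  assume "\<forall>x. (neg_laplacian ^^ m) u x = u x"
  then have eq: "(neg_laplacian ^^ m) u = u"
    by blast
  have "bounded_partials 0 u"
    using assms by (simp add: L_infinity_imp_bounded smooth_imp_continuous)
  from polyharmonic_eigenfunction[OF this assms(3) eq]
  show "\<forall>x. neg_laplacian u x = u x"
    by simp
next
  assume "\<forall>x. neg_laplacian u x = u x"
  then have eq: "neg_laplacian u = u"
    by blast
  have "(neg_laplacian ^^ m) u = u"
    by (induction m) (simp_all add: eq)
  then show "\<forall>x. (neg_laplacian ^^ m) u x = u x"
    by simp
qed

end
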